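(* Let $G=(N^+,E)$ be a connected undirected graph on the $n+1$ nodes $N^+=\{0,\dots,n\}$ and let $c(G)$ be any chordal extension of $G$. For an $(n+1)\times(n+1)$ complex matrix $W$ and partial matrices $W_{c(G)}$ on $c(G)$ and $W_G$ on $G$, all assumed to have strictly positive diagonal entries ($W_{jj}>0$, $[W_{c(G)}]_{jj}>0$, $[W_G]_{jj}>0$ for $j\in N^+$), the following hold. (1) If $W\succeq 0$ and $\operatorname{rank}W=1$, then its submatrix $W_{c(G)}$ on $c(G)$ satisfies $W_{c(G)}\succeq0$ and $\operatorname{rank}W_{c(G)}=1$. (2) If a partial matrix $W_{c(G)}$ satisfies $W_{c(G)}\succeq 0$ and $\operatorname{rank}W_{c(G)}=1$, then its submatrix $W_G$ on $G$ satisfies $W_G(j,k)\succeq0$ and $\operatorname{rank}W_G(j,k)=1$ for all $(j,k)\in E$, and satisfies the cycle condition. (3) If a partial matrix $W_G$ satisfies $W_G(j,k)\succeq0$ and $\operatorname{rank}W_G(j,k)=1$ for all $(j,k)\in E$, and satisfies the cycle condition, then there is a completion $W$ of $W_G$ with $W\succeq 0$ and $\operatorname{rank}W=1$.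
   Context: For an undirected graph $F$, a partial matrix $W_F$ on $F$ is a collection of complex numbers $[W_F]_{jj}$ (nodes $j$ of $F$) and $[W_F]_{jk},[W_F]_{kj}$ (edges $(j,k)$ of $F$). A completion of $W_F$ is a full square matrix $W$ indexed by the nodes with $W_{jj}=[W_F]_{jj}$ and $W_{jk}=[W_F]_{jk}$ for all nodes $j$ and edges $(j,k)$ of $F$. The submatrix on $F$ of a matrix (or of a partial matrix on a supergraph) is the partial matrix of its entries on nodes and edges of $F$. For a clique $q$ (complete subgraph) of $F$, $W_F(q)$ is the fully specified principal submatrix on $q$; for an edge $(j,k)$, $W_F(j,k)$ is the $2\times2$ matrix with rows $([W_F]_{jj},[W_F]_{jk})$ and $([W_F]_{kj},[W_F]_{kk})$. For a full matrix $A\succeq0$ means Hermitian positive semidefinite. For a partial matrix, $W_F\succeq0$ means $W_F$ is Hermitian ($[W_F]_{jk}=[W_F]_{kj}^H$) and $W_F(q)\succeq0$ for all cliques $q$ of $F$; $\operatorname{rank}W_F=1$ means $\operatorname{rank}W_F(q)=1$ for all cliques $q$ of $F$. A graph is chordal if all its minimal (chordless) cycles have length three (or it has no cycle). A chordal extension of $G$ is a chordal graph on the same nodes whose edge set contains that of $G$. $W_G$ satisfies the cycle condition if for every cycle $c=(j_1,\dots,j_K)$ in $G$ (with $(j_i,j_{i+1})\in E$, $j_{K+1}:=j_1$), $\sum_{i=1}^K\angle[W_G]_{j_ij_{i+1}}=0 \mod 2\pi$, where $\angle a$ is the argument of $a$. *)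

theory Defs
  imports
    "Jordan_Normal_Form.Schur_Decomposition"
    "Jordan_Normal_Form.DL_Rank"
    "Jordan_Normal_Form.DL_Submatrix"
    "Graph_Theory.Graph_Theory"
    "HOL-Library.Real_Mod"
begin

text \<open>Finite simple undirected graphs are the symmetric loop-free digraphs of the locale
  \<^locale>\<open>pair_graph\<close>: an edge between \<open>j\<close> and \<open>k\<close> is present as both arcs \<open>(j, k)\<close> and \<open>(k, j)\<close>.\<close>

definition clique :: "'a pair_pre_digraph \<Rightarrow> 'a set \<Rightarrow> bool" where
  "clique F q \<longleftrightarrow> q \<noteq> {} \<and> q \<subseteq> pverts F \<and> (\<forall>j\<in>q. \<forall>k\<in>q. j \<noteq> k \<longrightarrow> (j, k) \<in> parcs F)"

text \<open>The list \<open>[j\<^sub>1, \<dots>, j\<^sub>K]\<close> stands for the cycle \<open>j\<^sub>1 \<dots> j\<^sub>K j\<^sub>1\<close>. The predicate \<open>cycle\<close> of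
  \<^locale>\<open>pre_digraph\<close> also admits the walks \<open>j k j\<close>, which are not cycles of an undirected graph.\<close>

definition ucycle :: "'a pair_pre_digraph \<Rightarrow> 'a list \<Rightarrow> bool" where
  "ucycle F c \<longleftrightarrow> 3 \<le> length c \<and> vpath c (with_proj F) \<and> (last c, hd c) \<in> parcs F"

definition chordless :: "'a pair_pre_digraph \<Rightarrow> 'a list \<Rightarrow> bool" where
  "chordless F c \<longleftrightarrow> (\<forall>i<length c. \<forall>k<length c. (c ! i, c ! k) \<in> parcs F \<longrightarrow>
     k = (i + 1) mod length c \<or> i = (k + 1) mod length c)"

definition chordal :: "'a pair_pre_digraph \<Rightarrow> bool" where
  "chordal F \<longleftrightarrow> (\<forall>c. ucycle F c \<and> chordless F c \<longrightarrow> length c = 3)"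

definition chordal_extension :: "'a pair_pre_digraph \<Rightarrow> 'a pair_pre_digraph \<Rightarrow> bool" where
  "chordal_extension G H \<longleftrightarrow> pair_graph H \<and> spanning (with_proj G) (with_proj H) \<and> chordal H"

text \<open>The order on \<^typ>\<open>complex\<close> is the one of \<^theory>\<open>HOL-Library.Complex_Order\<close>: \<open>0 \<le> z\<close> and
  \<open>0 < z\<close> include that \<open>z\<close> is real.\<close>

definition psd :: "complex mat \<Rightarrow> bool" where
  "psd A \<longleftrightarrow> square_mat A \<and> mat_adjoint A = A \<and>
     (\<forall>v \<in> carrier_vec (dim_row A). 0 \<le> (A *\<^sub>v v) \<bullet>c v)"

abbreviation mat_rank :: "complex mat \<Rightarrow> nat" where
  "mat_rank A \<equiv> vec_space.rank (dim_row A) A"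

definition pos_diag :: "complex mat \<Rightarrow> bool" where
  "pos_diag A \<longleftrightarrow> (\<forall>j<dim_row A. 0 < A $$ (j, j))"

definition positions :: "nat pair_pre_digraph \<Rightarrow> (nat \<times> nat) set" where
  "positions F = {(j, j) |j. j \<in> pverts F} \<union> parcs F"

text \<open>A partial matrix on \<open>F\<close> is a finite map whose domain is exactly \<open>positions F\<close>.\<close>

type_synonym pmat = "nat \<times> nat \<rightharpoonup> complex"

definition partial_mat :: "nat pair_pre_digraph \<Rightarrow> pmat \<Rightarrow> bool" where
  "partial_mat F w \<longleftrightarrow> dom w = positions F"

definition ent :: "pmat \<Rightarrow> nat \<Rightarrow> nat \<Rightarrow> complex" where
  "ent w j k = the (w (j, k))"

definition mat_on :: "nat pair_pre_digraph \<Rightarrow> complex mat \<Rightarrow> pmat" where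
  "mat_on F W = (\<lambda>e. if e \<in> positions F then Some (W $$ e) else None)"

definition pmat_on :: "nat pair_pre_digraph \<Rightarrow> pmat \<Rightarrow> pmat" where
  "pmat_on F w = w |` positions F"

definition completion :: "nat pair_pre_digraph \<Rightarrow> pmat \<Rightarrow> complex mat \<Rightarrow> bool" where
  "completion F w W \<longleftrightarrow> W \<in> carrier_mat (card (pverts F)) (card (pverts F)) \<and>
     (\<forall>(j, k) \<in> positions F. W $$ (j, k) = ent w j k)"

text \<open>\<^term>\<open>pick q i\<close> is the \<open>i\<close>-th smallest element of \<open>q\<close>, counting from \<open>0\<close>.\<close>

definition clique_mat :: "pmat \<Rightarrow> nat set \<Rightarrow> complex mat" where
  "clique_mat w q = mat (card q) (card q) (\<lambda>(a, b). ent w (pick q a) (pick q b))"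

definition edge_mat :: "pmat \<Rightarrow> nat \<Rightarrow> nat \<Rightarrow> complex mat" where
  "edge_mat w j k = mat_of_rows_list 2 [[ent w j j, ent w j k], [ent w k j, ent w k k]]"

definition ppsd :: "nat pair_pre_digraph \<Rightarrow> pmat \<Rightarrow> bool" where
  "ppsd F w \<longleftrightarrow> (\<forall>(j, k) \<in> positions F. ent w j k = cnj (ent w k j)) \<and>
     (\<forall>q. clique F q \<longrightarrow> psd (clique_mat w q))"

definition prank1 :: "nat pair_pre_digraph \<Rightarrow> pmat \<Rightarrow> bool" where
  "prank1 F w \<longleftrightarrow> (\<forall>q. clique F q \<longrightarrow> mat_rank (clique_mat w q) = 1)"

definition edgewise_psd_rank1 :: "nat pair_pre_digraph \<Rightarrow> pmat \<Rightarrow> bool" where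
  "edgewise_psd_rank1 F w \<longleftrightarrow>
     (\<forall>(j, k) \<in> parcs F. psd (edge_mat w j k) \<and> mat_rank (edge_mat w j k) = 1)"

definition cycle_condition :: "nat pair_pre_digraph \<Rightarrow> pmat \<Rightarrow> bool" where
  "cycle_condition F w \<longleftrightarrow> (\<forall>c. ucycle F c \<longrightarrow>
     [(\<Sum>i<length c. Arg (ent w (c ! i) (c ! ((i + 1) mod length c)))) = 0] (rmod (2 * pi)))"

definition ppos_diag :: "nat pair_pre_digraph \<Rightarrow> pmat \<Rightarrow> bool" where
  "ppos_diag F w \<longleftrightarrow> (\<forall>j \<in> pverts F. 0 < ent w j j)"

end

theory Submission
  imports Defs "Jordan_Normal_Form.DL_Rank_Submatrix"
begin

text \<open>
  A positive semidefinite matrix of rank one with positive diagonal is an outer product \<open>v v\<^sup>*\<close> with no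
  zero entry in \<open>v\<close>; conversely, a rank-one matrix has vanishing \<open>2 \<times> 2\<close> minors. This gives (1), and on the
  cliques of the chordal extension it gives \<open>w\<^sub>j\<^sub>k w\<^sub>k\<^sub>j = w\<^sub>j\<^sub>j w\<^sub>k\<^sub>k\<close> on edges and a positive product of the
  entries around each triangle.

  Since the argument of a product is the sum of the arguments, the cycle condition says that the phases
  \<open>sgn w\<^sub>j\<^sub>k\<close> multiply to \<open>1\<close> around every cycle. A chord splits a cycle into two shorter ones, and the phase
  factors of the chord in its two directions cancel. Hence in a chordal graph the triangles suffice, which
  is (2).

  For (3), repeated vertices split a closed walk into shorter closed walks, so the phases multiply to \<open>1\<close>
  around every closed walk. Their product along a walk from a fixed root therefore depends only on the
  endpoint and defines a potential \<open>\<theta>\<close>. The vector with entries \<open>sqrt w\<^sub>j\<^sub>j * cnj \<theta>\<^sub>j\<close> generates the completion.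
\<close>

section \<open>Rank-one matrices\<close>

lemma mat_adjoint_index:
  fixes A :: "complex mat"
  assumes "i < dim_col A" "j < dim_row A"
  shows "mat_adjoint A $$ (i, j) = cnj (A $$ (j, i))"
  using assms by (simp add: mat_adjoint_def mat_of_rows_index)

lemma mat_adjoint_dim [simp]:
  "dim_row (mat_adjoint A) = dim_col A" "dim_col (mat_adjoint A) = dim_row A"
  by (simp_all add: mat_adjoint_def)

section \<open>Minors of rank-one matrices\<close>

lemma pick_two:
  fixes i k :: nat
  assumes "i < k"
  shows "pick {i, k} 0 = i" "pick {i, k} (Suc 0) = k"
proof -
  have "{a \<in> {i, k}. a < i} = {}" "{a \<in> {i, k}. a < k} = {i}"
    using assms by auto
  then have "card {a \<in> {i, k}. a < i} = 0" "card {a \<in> {i, k}. a < k} = Suc 0"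
    by (simp_all only: card.empty card_1_singleton_iff) blast
  then show "pick {i, k} 0 = i" "pick {i, k} (Suc 0) = k"
    using pick_card_in_set[of i "{i, k}"] pick_card_in_set[of k "{i, k}"] by (metis insertCI)+
qed

text \<open>A nonsingular \<open>2 \<times> 2\<close> submatrix would force rank at least 2. Both
  index pairs are increasing because \<open>submatrix\<close> lists the chosen rows and columns in
  increasing order through \<open>pick\<close>.\<close>

lemma (in vec_space) rank_1_minor_ordered:
  assumes "A \<in> carrier_mat n nc" "rank A \<le> 1" "i < k" "k < n" "j < l" "l < nc"
  shows "A $$ (i, j) * A $$ (k, l) = A $$ (i, l) * A $$ (k, j)"
proof -
  define S where "S = submatrix A {i, k} {j, l}"
  have rows: "{r. r < dim_row A \<and> r \<in> {i, k}} = {i, k}"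
    and cols: "{c. c < dim_col A \<and> c \<in> {j, l}} = {j, l}"
    using assms by auto
  have S: "S \<in> carrier_mat 2 2"
    unfolding S_def carrier_mat_def mem_Collect_eq dim_submatrix rows cols using assms by auto
  have ent: "S $$ (0, 0) = A $$ (i, j)" "S $$ (0, 1) = A $$ (i, l)"
    "S $$ (1, 0) = A $$ (k, j)" "S $$ (1, 1) = A $$ (k, l)"
    unfolding S_def using assms(3,5)
    by (subst submatrix_index; simp only: rows cols; simp add: pick_two del: pick.simps)+
  have "card {c. c < nc \<and> c \<in> {j, l}} = 2"
    using cols assms by auto
  then have "det S = 0"
    using rank_gt_minor[OF assms(1), of "{i, k}" "{j, l}"] assms(2) unfolding S_def by force
  then obtain v where v: "v \<in> carrier_vec 2" "v \<noteq> 0\<^sub>v 2" "S *\<^sub>v v = 0\<^sub>v 2"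
    using det_0_iff_vec_prod_zero_field[OF S] by auto
  have mult: "S $$ (r, 0) * v $ 0 + S $$ (r, 1) * v $ 1 = 0" if "r < 2" for r
  proof -
    have "(S *\<^sub>v v) $ r = 0"
      using v(3) that by simp
    then show ?thesis
      using that S v(1) by (simp add: scalar_prod_def numeral_2_eq_2)
  qed
  have nz: "v $ 0 \<noteq> 0 \<or> v $ 1 \<noteq> 0"
  proof (rule ccontr)
    assume "\<not> ?thesis"
    then have "v = 0\<^sub>v 2"
      using v(1) by (intro eq_vecI) (auto simp: less_2_cases_iff)
    then show False
      using v(2) by simp
  qed
  \<comment> \<open>Eliminating either unknown shows that the determinant annihilates both
    coordinates of the kernel vector, one of which is nonzero.\<close>
  have cross: "a * d = b * c"
    if "a * x + b * y = 0" "c * x + d * y = 0" "x \<noteq> 0 \<or> y \<noteq> 0" for a b c d x y :: 'a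
  proof -
    have "(a * d - b * c) * x = d * (a * x + b * y) - b * (c * x + d * y)"
      "(a * d - b * c) * y = a * (c * x + d * y) - c * (a * x + b * y)"
      by (simp_all add: algebra_simps)
    then show ?thesis
      using that by auto
  qed
  have "S $$ (0, 0) * S $$ (1, 1) = S $$ (0, 1) * S $$ (1, 0)"
    by (rule cross[OF mult[of 0] mult[of 1] nz]) simp_all
  then show ?thesis
    unfolding ent .
qed

lemma (in vec_space) rank_1_minor:
  assumes "A \<in> carrier_mat n nc" "rank A \<le> 1" "i < n" "k < n" "j < nc" "l < nc"
  shows "A $$ (i, j) * A $$ (k, l) = A $$ (i, l) * A $$ (k, j)"
proof -
  note minor = rank_1_minor_ordered[OF assms(1,2)]
  consider "i = k \<or> j = l" | "i < k" "j < l" | "i < k" "l < j" | "k < i" "j < l" | "k < i" "l < j"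
    by linarith
  then show ?thesis
  proof cases
    case 1
    then show ?thesis
      by (auto simp: mult.commute)
  next
    case 2
    then show ?thesis
      using assms by (intro minor)
  next
    case 3
    then show ?thesis
      using assms by (intro minor[symmetric])
  next
    case 4
    then show ?thesis
      using minor[of k i j l] assms by (simp add: mult.commute)
  next
    case 5
    then show ?thesis
      using minor[of k i l j] assms by (simp add: mult.commute)
  qed
qed

text \<open>A nonzero entry is a nonvanishing \<open>1 \<times> 1\<close> minor.\<close>

lemma (in vec_space) rank_ge_1:
  assumes "A \<in> carrier_mat n nc" "i < n" "j < nc" "A $$ (i, j) \<noteq> 0"
  shows "1 \<le> rank A"
proof -
  have rows: "{r. r < dim_row A \<and> r \<in> {i}} = {i}"
    and cols: "{c. c < dim_col A \<and> c \<in> {j}} = {j}"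
    using assms by auto
  have S: "submatrix A {i} {j} \<in> carrier_mat 1 1"
    unfolding carrier_mat_def mem_Collect_eq dim_submatrix rows cols by auto
  have "submatrix A {i} {j} $$ (0, 0) = A $$ (i, j)"
    by (subst submatrix_index; (simp only: rows cols)?; simp add: Least_equality)
  then have "det (submatrix A {i} {j}) \<noteq> 0"
    using det_single[OF S] assms(4) by simp
  then have "card {c. c < nc \<and> c \<in> {j}} \<le> rank A"
    by (rule rank_gt_minor[OF assms(1)])
  moreover have "{c. c < nc \<and> c \<in> {j}} = {j}"
    using assms(3) by auto
  ultimately show ?thesis
    by simp
qed

section \<open>Outer products\<close>

lemma outer_product_psd_rank_1:
  fixes A :: "complex mat"
  assumes A: "A \<in> carrier_mat m m"
    and ent: "\<And>i j. i < m \<Longrightarrow> j < m \<Longrightarrow> A $$ (i, j) = v i * cnj (v j)"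
    and nz: "k < m" "v k \<noteq> 0"
  shows "psd A \<and> mat_rank A = 1"
proof
  have "0 \<le> (A *\<^sub>v x) \<bullet>c x" if x: "x \<in> carrier_vec m" for x
  proof -
    \<comment> \<open>The inner product of \<open>x\<close> with the generator \<open>v\<close>; the
      quadratic form of the outer product is its squared modulus.\<close>
    define s where "s = (\<Sum>j<m. cnj (v j) * x $ j)"
    have "(A *\<^sub>v x) \<bullet>c x = (\<Sum>i<m. (A *\<^sub>v x) $ i * cnj (x $ i))"
      using A x by (simp add: scalar_prod_def atLeast0LessThan)
    also have "\<dots> = (\<Sum>i<m. s * (v i * cnj (x $ i)))"
      using A x by (intro sum.cong)
        (auto simp: scalar_prod_def atLeast0LessThan ent s_def sum_distrib_left sum_distrib_right mult_ac)
    also have "\<dots> = s * cnj s"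
      by (simp add: s_def sum_distrib_left)
    also have "\<dots> \<ge> 0"
      by (simp add: complex_mult_cnj less_eq_complex_def)
    finally show ?thesis .
  qed
  moreover have "mat_adjoint A = A"
    using A by (intro eq_matI) (auto simp: mat_adjoint_index ent)
  ultimately show "psd A"
    using A by (auto simp: psd_def)
  have "vec_space.rank m A \<le> 1"
    using A ent by (intro vec_space.rank_le_1_product_entries[OF A, of v "\<lambda>j. cnj (v j)"]) auto
  moreover have "1 \<le> vec_space.rank m A"
    using vec_space.rank_ge_1[OF A nz(1) nz(1)] ent nz by simp
  ultimately show "mat_rank A = 1"
    using A by simp
qed

lemma psd_hermitian:
  assumes "psd A" "i < dim_row A" "j < dim_row A"
  shows "A $$ (i, j) = cnj (A $$ (j, i))"
  using assms mat_adjoint_index[of i A j] by (auto simp: psd_def)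

lemma pos_complexE:
  fixes z :: complex
  assumes "0 < z"
  obtains r where "0 < r" "z = complex_of_real r"
  using assms by (auto simp: less_complex_def complex_eq_iff)

lemma complex_of_real_sqrt_mult_self:
  "0 \<le> r \<Longrightarrow> complex_of_real (sqrt r) * complex_of_real (sqrt r) = complex_of_real r"
  by (simp flip: of_real_mult)

lemma psd_rank_1_outer_product:
  assumes "psd A" "mat_rank A = 1" "pos_diag A"
  obtains v where "\<And>i j. i < dim_row A \<Longrightarrow> j < dim_row A \<Longrightarrow> A $$ (i, j) = v i * cnj (v j)"
    "\<And>i. i < dim_row A \<Longrightarrow> v i \<noteq> 0"
proof (cases "dim_row A")
  case 0
  with that show ?thesis by simp
next
  case (Suc m)
  have A: "A \<in> carrier_mat (dim_row A) (dim_row A)"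
    using assms(1) by (auto simp: psd_def)
  obtain r where r: "0 < r" "A $$ (0, 0) = complex_of_real r"
    using assms(3) Suc by (auto simp: pos_diag_def elim: pos_complexE)
  \<comment> \<open>The minor on rows \<open>i\<close>, 0 and columns 0, \<open>j\<close> gives
    \<open>A\<^sub>i\<^sub>j A\<^sub>0\<^sub>0 = A\<^sub>i\<^sub>0 A\<^sub>0\<^sub>j\<close>, so the
    first column scaled by the square root of the corner generates the matrix.\<close>
  define v where "v i = A $$ (i, 0) / complex_of_real (sqrt r)" for i
  have outer: "A $$ (i, j) = v i * cnj (v j)" if "i < dim_row A" "j < dim_row A" for i j
  proof -
    have "A $$ (i, 0) * A $$ (0, j) = A $$ (i, j) * A $$ (0, 0)"
      using vec_space.rank_1_minor[OF A] assms(2) that Suc by auto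
    moreover have "A $$ (0, j) = cnj (A $$ (j, 0))"
      using psd_hermitian[OF assms(1), of 0 j] that Suc by simp
    ultimately show ?thesis
      using r complex_of_real_sqrt_mult_self[of r] by (simp add: v_def field_simps)
  qed
  moreover have "v i \<noteq> 0" if "i < dim_row A" for i
    using outer[OF that that] assms(3) that by (auto simp: pos_diag_def)
  ultimately show ?thesis
    using that by blast
qed

section \<open>Edge and clique submatrices\<close>

lemma edge_mat_index [simp]:
  "edge_mat w j k \<in> carrier_mat 2 2"
  "dim_row (edge_mat w j k) = 2"
  "edge_mat w j k $$ (0, 0) = ent w j j"
  "edge_mat w j k $$ (0, Suc 0) = ent w j k"
  "edge_mat w j k $$ (Suc 0, 0) = ent w k j"
  "edge_mat w j k $$ (Suc 0, Suc 0) = ent w k k"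
  by (simp_all add: edge_mat_def mat_of_rows_list_def numeral_2_eq_2)

text \<open>Reduces the matrix condition on an edge to Hermitian symmetry and a vanishing
  determinant. In the converse direction the scaled first column is again the generator, and the
  determinant equation yields its last entry.\<close>

lemma edge_mat_psd_rank_1_iff:
  assumes pos: "0 < ent w j j" "0 < ent w k k"
  shows "psd (edge_mat w j k) \<and> mat_rank (edge_mat w j k) = 1 \<longleftrightarrow>
    ent w k j = cnj (ent w j k) \<and> ent w j k * ent w k j = ent w j j * ent w k k"
    (is "?L \<longleftrightarrow> ?R")
proof
  assume L: ?L
  have "edge_mat w j k $$ (0, 0) * edge_mat w j k $$ (1, 1) =
      edge_mat w j k $$ (0, 1) * edge_mat w j k $$ (1, 0)"
    by (rule vec_space.rank_1_minor[OF edge_mat_index(1)]) (use L in auto)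
  then show ?R
    using L psd_hermitian[of "edge_mat w j k" 1 0] by auto
next
  assume R: ?R
  obtain r where r: "0 < r" "ent w j j = complex_of_real r"
    using pos(1) by (auto elim: pos_complexE)
  define v where "v i = edge_mat w j k $$ (i, 0) / complex_of_real (sqrt r)" for i
  have v: "v 0 * cnj (v 0) = ent w j j" "v 0 * cnj (v 1) = ent w j k"
    "v 1 * cnj (v 0) = ent w k j" "v 1 * cnj (v 1) = ent w k k"
    using r R complex_of_real_sqrt_mult_self[of r] by (auto simp: v_def field_simps)
  have "edge_mat w j k $$ (i, l) = v i * cnj (v l)" if "i < 2" "l < 2" for i l
    using that v by (auto simp: less_2_cases_iff)
  moreover have "v 0 \<noteq> 0"
    using v(1) r by auto
  ultimately show ?L
    by (intro outer_product_psd_rank_1[OF edge_mat_index(1)]) auto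
qed

lemma clique_mat_index [simp]:
  "clique_mat w q \<in> carrier_mat (card q) (card q)"
  "dim_row (clique_mat w q) = card q"
  "a < card q \<Longrightarrow> b < card q \<Longrightarrow> clique_mat w q $$ (a, b) = ent w (pick q a) (pick q b)"
  by (simp_all add: clique_mat_def)

lemma clique_mat_rank_1_minor:
  assumes "finite q" "mat_rank (clique_mat w q) = 1" "{i, j, k, l} \<subseteq> q"
  shows "ent w i j * ent w k l = ent w i l * ent w k j"
proof -
  \<comment> \<open>The position of node \<open>x\<close> in the increasing enumeration of the
    clique, a right inverse of \<open>pick q\<close> on \<open>q\<close>.\<close>
  define p where "p x = card {a \<in> q. a < x}" for x
  have p: "p x < card q \<and> pick q (p x) = x" if "x \<in> q" for x
    using that assms(1) pick_card_in_set[of x q] psubset_card_mono[of q "{a \<in> q. a < x}"]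
    by (auto simp: p_def)
  have "clique_mat w q $$ (p i, p j) * clique_mat w q $$ (p k, p l) =
      clique_mat w q $$ (p i, p l) * clique_mat w q $$ (p k, p j)"
    by (rule vec_space.rank_1_minor[OF clique_mat_index(1)]) (use assms p in auto)
  then show ?thesis
    using assms(3) p by auto
qed

section \<open>Products along walks\<close>

text \<open>A commutative monoid suffices: inverses enter only through hypotheses
  \<open>u x y * u y x = 1\<close> on arcs. Closed walks are written
  \<open>c @ [hd c]\<close>.\<close>

definition walk_prod :: "('a \<Rightarrow> 'a \<Rightarrow> 'b :: comm_monoid_mult) \<Rightarrow> 'a list \<Rightarrow> 'b" where
  "walk_prod u p = prod_list (map (case_prod u) (vwalk_arcs p))"

lemma vwalk_arcs_split: "vwalk_arcs (p @ x # q) = vwalk_arcs (p @ [x]) @ vwalk_arcs (x # q)"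
  by (induction p rule: vwalk_arcs.induct) auto

text \<open>The closing vertex is written \<open>hd (p @ [x])\<close>, which does not mention
  \<open>q\<close>; a closed walk and its shortening after \<open>x\<close> thus return to the same
  expression.\<close>

lemma vwalk_arcs_close_split:
  "vwalk_arcs ((p @ x # q) @ [hd (p @ x # q)]) =
    vwalk_arcs (p @ [x]) @ vwalk_arcs (x # q @ [hd (p @ [x])])"
  using vwalk_arcs_split[of p x "q @ [hd (p @ [x])]"] by (cases p) auto

lemma vwalk_arcs_conv_nth:
  "vwalk_arcs p = map (\<lambda>i. (p ! i, p ! Suc i)) [0..<length p - 1]"
proof (induction p rule: vwalk_arcs.induct)
  case (3 x y p)
  then show ?case
    by (simp add: upt_conv_Cons map_Suc_upt[symmetric] del: upt_Suc)
qed auto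

lemma vwalk_arcs_close_conv_nth:
  assumes "c \<noteq> []"
  shows "vwalk_arcs (c @ [hd c]) = map (\<lambda>i. (c ! i, c ! ((i + 1) mod length c))) [0..<length c]"
  using assms
  by (auto simp: vwalk_arcs_conv_nth nth_append hd_conv_nth mod_Suc)

lemma walk_prod_close_conv_prod:
  assumes "c \<noteq> []"
  shows "walk_prod u (c @ [hd c]) = (\<Prod>i<length c. u (c ! i) (c ! ((i + 1) mod length c)))"
  unfolding walk_prod_def vwalk_arcs_close_conv_nth[OF assms]
  by (simp add: comp_def prod.list_conv_set_nth atLeast0LessThan)

lemma walk_prod_rev:
  assumes "\<And>x y. (x, y) \<in> set (vwalk_arcs p) \<Longrightarrow> u x y * u y x = 1"
  shows "walk_prod u p * walk_prod u (rev p) = 1"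
  using assms
proof (induction p rule: vwalk_arcs.induct)
  case (3 x y p)
  have "walk_prod u (x # y # p) * walk_prod u (rev (x # y # p)) =
      (u x y * u y x) * (walk_prod u (y # p) * walk_prod u (rev (y # p)))"
    by (simp add: walk_prod_def vwalk_arcs_split[of "rev p" y "[x]"] mult_ac)
  then show ?case
    using 3 by simp
qed (auto simp: walk_prod_def)

section \<open>Cycles and chords\<close>

context pair_graph
begin

lemma parcs_sym: "(x, y) \<in> parcs G \<Longrightarrow> (y, x) \<in> parcs G"
  using arcs_symmetric by auto

lemma parcs_no_loop: "(x, x) \<notin> parcs G"
  using pair_no_loops by fastforce

text \<open>Each vertex of a closed list is the tail of one of its arcs, so membership in
  \<open>pverts G\<close> follows from the arcs. This form is easy to check after splitting a
  cycle.\<close>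

lemma ucycle_iff:
  "ucycle G c \<longleftrightarrow> 3 \<le> length c \<and> distinct c \<and> set (vwalk_arcs (c @ [hd c])) \<subseteq> parcs G"
proof (cases "c = []")
  case False
  then obtain b z where c: "c = b @ [z]"
    by (metis rev_exhaust)
  have arcs: "set (vwalk_arcs (c @ [hd c])) = insert (last c, hd c) (set (vwalk_arcs c))"
    using vwalk_arcs_append[of c "[hd c]"] False by auto
  have "set c \<subseteq> pverts G" if "set (vwalk_arcs (c @ [hd c])) \<subseteq> parcs G"
  proof
    fix x assume "x \<in> set c"
    then obtain i where i: "i < length c" "c ! i = x"
      by (auto simp: in_set_conv_nth)
    then have "(x, c ! ((i + 1) mod length c)) \<in> parcs G"
      using that by (auto simp: vwalk_arcs_close_conv_nth[OF False])
    then show "x \<in> pverts G"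
      by (rule in_arcsD1)
  qed
  then show ?thesis
    using False arcs by (auto simp: ucycle_def vpath_def vwalk_def)
qed (auto simp: ucycle_def)

text \<open>One half replaces \<open>q\<close> by the arc from \<open>x\<close> to \<open>y\<close>;
  the other follows \<open>q\<close> and returns by the opposite arc. Nonemptiness of
  \<open>q\<close> and of \<open>p @ r\<close> means that \<open>x\<close> and \<open>y\<close> are
  not consecutive, so both halves have length at least three.\<close>

lemma cycle_split_at_chord:
  fixes u :: "'a \<Rightarrow> 'a \<Rightarrow> 'b :: comm_monoid_mult"
  assumes c: "ucycle G c" "c = p @ x # q @ y # r" "q \<noteq> []" "p @ r \<noteq> []"
    and chord: "(x, y) \<in> parcs G" "u x y * u y x = 1"
  shows "ucycle G (p @ x # y # r)" "ucycle G (x # q @ [y])"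
    "walk_prod u (c @ [hd c]) =
      walk_prod u ((p @ x # y # r) @ [hd (p @ x # y # r)]) * walk_prod u ((x # q @ [y]) @ [x])"
proof -
  define h where "h = hd (p @ [x])"
  have arcs: "vwalk_arcs (c @ [hd c]) =
      vwalk_arcs (p @ [x]) @ vwalk_arcs (x # q @ [y]) @ vwalk_arcs (y # r @ [h])"
    "vwalk_arcs ((p @ x # y # r) @ [hd (p @ x # y # r)]) =
      vwalk_arcs (p @ [x]) @ (x, y) # vwalk_arcs (y # r @ [h])"
    "vwalk_arcs ((x # q @ [y]) @ [x]) = vwalk_arcs (x # q @ [y]) @ [(y, x)]"
    unfolding vwalk_arcs_close_split c(2) h_def[symmetric]
    using vwalk_arcs_split[of "x # q" y "r @ [h]"] vwalk_arcs_split[of "x # q" y "[x]"] by auto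
  show "ucycle G (p @ x # y # r)"
    unfolding ucycle_iff arcs
    using c(1)[unfolded ucycle_iff arcs] c(2,4) chord by (cases p; cases r) auto
  have "set (vwalk_arcs ((x # q @ [y]) @ [x])) \<subseteq> parcs G"
    unfolding arcs using c(1)[unfolded ucycle_iff arcs] parcs_sym[OF chord(1)] by auto
  moreover have "3 \<le> length (x # q @ [y])"
    using c(3) by (cases q) auto
  ultimately show "ucycle G (x # q @ [y])"
    using c(1)[unfolded ucycle_iff] c(2) by (auto simp: ucycle_iff)
  \<comment> \<open>The inserted factor 1 supplies the two directions of the chord, one for each
    half.\<close>
  have "walk_prod u (c @ [hd c]) = (u x y * u y x) * walk_prod u (c @ [hd c])"
    using chord by simp
  also have "\<dots> = walk_prod u ((p @ x # y # r) @ [hd (p @ x # y # r)]) * walk_prod u ((x # q @ [y]) @ [x])"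
    unfolding walk_prod_def arcs by (simp add: mult_ac)
  finally show "walk_prod u (c @ [hd c]) =
      walk_prod u ((p @ x # y # r) @ [hd (p @ x # y # r)]) * walk_prod u ((x # q @ [y]) @ [x])" .
qed

lemma not_chordless_obtains_chord:
  assumes "\<not> chordless G c"
  obtains p x q y r where "c = p @ x # q @ y # r" "q \<noteq> []" "p @ r \<noteq> []" "(x, y) \<in> parcs G"
proof -
  \<comment> \<open>The arc relation and adjacency on the cycle are both symmetric, so the two
    indices can be ordered.\<close>
  obtain i k where ik: "i < length c" "k < length c" "i < k" "(c ! i, c ! k) \<in> parcs G"
    "k \<noteq> i + 1" "i \<noteq> (k + 1) mod length c"
  proof -
    from assms obtain i k where *: "i < length c" "k < length c" "(c ! i, c ! k) \<in> parcs G"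
      "k \<noteq> (i + 1) mod length c" "i \<noteq> (k + 1) mod length c"
      unfolding chordless_def by blast
    then have "i \<noteq> k"
      using parcs_no_loop by auto
    then show thesis
      using * parcs_sym that[of i k] that[of k i] by (cases "i < k") auto
  qed
  define p q r where "p = take i c" and "q = take (k - i - 1) (drop (Suc i) c)"
    and "r = drop (Suc k) c"
  have "c = p @ c ! i # drop (Suc i) c"
    using ik(1) by (simp add: p_def id_take_nth_drop)
  moreover have "drop (Suc i) c = q @ drop (k - i - 1) (drop (Suc i) c)"
    unfolding q_def by (rule append_take_drop_id[symmetric])
  moreover have "drop (k - i - 1) (drop (Suc i) c) = c ! k # r"
    using ik by (simp add: r_def Cons_nth_drop_Suc)
  ultimately have "c = p @ c ! i # q @ c ! k # r"
    by metis
  moreover have "q \<noteq> []"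
    using ik by (simp add: q_def)
  \<comment> \<open>If both parts were empty, \<open>i\<close> and \<open>k\<close> would be the
    first and last indices, which the closing arc makes adjacent.\<close>
  moreover have "p @ r \<noteq> []"
    using ik by (cases "k + 1 = length c") (auto simp: p_def r_def)
  ultimately show thesis
    using ik(4) that by blast
qed

text \<open>Strong induction on the length: a cycle longer than three has a chord by chordality, and
  both halves cut off by it are shorter.\<close>

lemma chordal_cycle_walk_prod:
  fixes u :: "'a \<Rightarrow> 'a \<Rightarrow> 'b :: comm_monoid_mult"
  assumes "chordal G"
    and arc: "\<And>x y. (x, y) \<in> parcs G \<Longrightarrow> u x y * u y x = 1"
    and triangle: "\<And>x y z. clique G {x, y, z} \<Longrightarrow> u x y * u y z * u z x = 1"
    and "ucycle G c"
  shows "walk_prod u (c @ [hd c]) = 1"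
  using \<open>ucycle G c\<close>
proof (induction "length c" arbitrary: c rule: less_induct)
  case less
  show ?case
  proof (cases "length c = 3")
    case True
    then obtain x y z where c: "c = [x, y, z]"
      by (auto simp: numeral_3_eq_3 length_Suc_conv)
    then have arcs: "(x, y) \<in> parcs G" "(y, z) \<in> parcs G" "(z, x) \<in> parcs G"
      using less.prems by (auto simp: ucycle_iff)
    then have "clique G {x, y, z}"
      using parcs_sym in_arcsD1 by (auto simp: clique_def)
    then show ?thesis
      using triangle by (simp add: c walk_prod_def mult_ac)
  next
    case False
    then have "\<not> chordless G c"
      using less.prems \<open>chordal G\<close> by (auto simp: chordal_def)
    then obtain p x q y r where split: "c = p @ x # q @ y # r" "q \<noteq> []" "p @ r \<noteq> []"
      and xy: "(x, y) \<in> parcs G"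
      by (rule not_chordless_obtains_chord)
    note halves = cycle_split_at_chord[of c p x q y r u, OF less.prems split xy arc[OF xy]]
    have "length (p @ x # y # r) < length c" "length (x # q @ [y]) < length c"
      using split by (auto simp: neq_Nil_conv)
    then show ?thesis
      using less.hyps[OF _ halves(1)] less.hyps[OF _ halves(2)] halves(3) by simp
  qed
qed

section \<open>Closed walks and potentials\<close>

lemma closed_walk_prod:
  fixes u :: "'a \<Rightarrow> 'a \<Rightarrow> 'b :: comm_monoid_mult"
  assumes arc: "\<And>x y. (x, y) \<in> parcs G \<Longrightarrow> u x y * u y x = 1"
    and cycle: "\<And>c. ucycle G c \<Longrightarrow> walk_prod u (c @ [hd c]) = 1"
    and "p \<noteq> []" "set (vwalk_arcs (p @ [hd p])) \<subseteq> parcs G"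
  shows "walk_prod u (p @ [hd p]) = 1"
  using assms(3,4)
proof (induction "length p" arbitrary: p rule: less_induct)
  case less
  show ?case
  proof (cases "distinct p")
    case True
    \<comment> \<open>A cycle has at least three vertices, so two kinds of distinct lists remain: a
      loop, which \<open>G\<close> lacks, and an edge traversed back and forth.\<close>
    consider (1) x where "p = [x]" | (2) x y where "p = [x, y]" | (3) "3 \<le> length p"
    proof (cases p rule: remdups_adj.cases)
      case (3 x y q)
      then show thesis
        using that by (cases q) auto
    qed (use less.prems that in auto)
    then show ?thesis
    proof cases
      case 1
      then show ?thesis
        using less.prems parcs_no_loop by auto
    next
      case 2
      then show ?thesis
        using less.prems arc by (auto simp: walk_prod_def)
    next
      case 3
      then show ?thesis
        using True less.prems by (intro cycle) (auto simp: ucycle_iff)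
    qed
  next
    case False
    \<comment> \<open>The part between two visits of \<open>y\<close> is a closed walk of its own;
      removing it leaves another, and both are shorter.\<close>
    then obtain a y b d where p: "p = a @ y # b @ y # d"
      using not_distinct_decomp[OF False] by auto
    define h where "h = hd (a @ [y])"
    have arcs: "vwalk_arcs (p @ [hd p]) =
        vwalk_arcs (a @ [y]) @ vwalk_arcs (y # b @ [y]) @ vwalk_arcs (y # d @ [h])"
      "vwalk_arcs ((a @ y # d) @ [hd (a @ y # d)]) = vwalk_arcs (a @ [y]) @ vwalk_arcs (y # d @ [h])"
      unfolding vwalk_arcs_close_split p h_def[symmetric]
      using vwalk_arcs_split[of "y # b" y "d @ [h]"] by auto
    have outer: "walk_prod u ((a @ y # d) @ [hd (a @ y # d)]) = 1"
      by (rule less.hyps) (use less.prems arcs in \<open>auto simp: p\<close>)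
    have inner: "walk_prod u ((y # b) @ [hd (y # b)]) = 1"
      by (rule less.hyps) (use less.prems arcs in \<open>auto simp: p\<close>)
    have "walk_prod u (p @ [hd p]) =
        walk_prod u ((a @ y # d) @ [hd (a @ y # d)]) * walk_prod u ((y # b) @ [hd (y # b)])"
      unfolding walk_prod_def arcs by (simp add: mult_ac)
    then show ?thesis
      unfolding outer inner by simp
  qed
qed

text \<open>Two walks from the root that differ by an arc close up to a walk of product 1. The
  second conclusion exposes \<open>\<theta>\<close> as a walk product, so that properties of
  \<open>u\<close> such as unit modulus carry over to it.\<close>

lemma connected_potential:
  fixes u :: "'a \<Rightarrow> 'a \<Rightarrow> 'b :: comm_monoid_mult"
  assumes "connected G"
    and arc: "\<And>x y. (x, y) \<in> parcs G \<Longrightarrow> u x y * u y x = 1"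
    and cycle: "\<And>c. ucycle G c \<Longrightarrow> walk_prod u (c @ [hd c]) = 1"
  obtains \<theta> where "\<And>x y. (x, y) \<in> parcs G \<Longrightarrow> \<theta> y = \<theta> x * u x y"
    "\<And>x. x \<in> pverts G \<Longrightarrow> \<exists>p. set (vwalk_arcs p) \<subseteq> parcs G \<and> \<theta> x = walk_prod u p"
proof -
  obtain s where s: "s \<in> pverts G"
    using assms(1) by (auto simp: connected_def strongly_connected_def)
  have "\<exists>p. vwalk p G \<and> hd p = s \<and> last p = x" if "x \<in> pverts G" for x
  proof -
    have "s \<rightarrow>\<^sup>*\<^bsub>mk_symmetric G\<^esub> x"
      using assms(1) s that by (auto simp: connected_def strongly_connected_def)
    then show ?thesis
      by (simp add: reachable_mk_symmetric_eq[OF pair_sym_arcs] reachable_vwalk_conv)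
  qed
  then obtain P where "\<And>x. x \<in> pverts G \<Longrightarrow> vwalk (P x) G \<and> hd (P x) = s \<and> last (P x) = x"
    by metis
  then have P: "P x \<noteq> []" "set (vwalk_arcs (P x)) \<subseteq> parcs G" "hd (P x) = s" "last (P x) = x"
    if "x \<in> pverts G" for x
    using that by (auto simp: vwalk_def)
  have "walk_prod u (P y) = walk_prod u (P x) * u x y" if xy: "(x, y) \<in> parcs G" for x y
  proof -
    have v: "x \<in> pverts G" "y \<in> pverts G"
      using xy in_arcsD1 in_arcsD2 by auto
    have rev_sub: "set (vwalk_arcs (rev (P y))) \<subseteq> parcs G"
      using P(2)[OF v(2)] parcs_sym by (auto simp: set_vwalk_arcs_rev)
    \<comment> \<open>Dropping the final root \<open>s\<close> from the reversed walk lets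
      \<open>P x @ q\<close>, closed by its own head \<open>s\<close>, be the whole walk from
      \<open>s\<close> through \<open>x\<close> and \<open>y\<close> back to
      \<open>s\<close>.\<close>
    obtain q where q: "rev (P y) = q @ [s]"
      using P(1,3)[OF v(2)] by (metis hd_Cons_tl rev.simps(2))
    have hd_q: "hd (q @ [s]) = y"
      using P(4)[OF v(2)] q P(1)[OF v(2)] by (metis hd_rev)
    have arcs: "vwalk_arcs (P x @ rev (P y)) = vwalk_arcs (P x) @ (x, y) # vwalk_arcs (rev (P y))"
      using vwalk_arcs_append[of "P x" "rev (P y)"] P v by (simp add: hd_rev)
    have close: "(P x @ q) @ [hd (P x @ q)] = P x @ rev (P y)"
      using P v q by simp
    have "walk_prod u (P x @ rev (P y)) = 1"
      using closed_walk_prod[of u "P x @ q", OF arc cycle] P(1)[OF v(1)]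
      unfolding close arcs using P(2)[OF v(1)] rev_sub xy by auto
    then have "walk_prod u (P x) * u x y * walk_prod u (rev (P y)) = 1"
      unfolding walk_prod_def arcs by (simp add: mult_ac)
    moreover have "walk_prod u (P y) * walk_prod u (rev (P y)) = 1"
      using P(2)[OF v(2)] by (intro walk_prod_rev arc) auto
    \<comment> \<open>Inverses in a commutative monoid are unique; this stands in for
      division.\<close>
    moreover have "b = a" if "a * c = 1" "b * c = 1" for a b c :: 'b
    proof -
      have "b = b * (a * c)"
        using that by simp
      also have "\<dots> = b * c * a"
        by (simp add: mult_ac)
      finally show ?thesis
        using that by simp
    qed
    ultimately show ?thesis
      by blast
  qed
  then show thesis
    using that[of "\<lambda>x. walk_prod u (P x)"] P(2) by blast
qed

end

section \<open>Phases of partial matrices\<close>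

lemma cis_sum: "cis (sum f S) = (\<Prod>x\<in>S. cis (f x))"
  by (induction S rule: infinite_finite_induct) (simp_all flip: cis_mult)

lemma sgn_pos_complex:
  fixes z :: complex
  assumes "0 < z"
  shows "sgn z = 1"
  using assms by (auto simp: sgn_of_real elim: pos_complexE)

text \<open>For nonzero \<open>z\<close>, \<open>sgn z = cis (Arg z)\<close>, and \<open>cis\<close>
  turns sums into products with kernel the multiples of \<open>2 * pi\<close>. At zero this fails,
  since \<open>Arg 0 = 0\<close> while \<open>sgn 0 = 0\<close>.\<close>

lemma cycle_condition_iff:
  assumes "pair_graph F" and nz: "\<And>j k. (j, k) \<in> parcs F \<Longrightarrow> ent w j k \<noteq> 0"
  shows "cycle_condition F w \<longleftrightarrow>
    (\<forall>c. ucycle F c \<longrightarrow> walk_prod (\<lambda>j k. sgn (ent w j k)) (c @ [hd c]) = 1)"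
proof -
  interpret F: pair_graph F by fact
  have "[(\<Sum>i<length c. Arg (ent w (c ! i) (c ! ((i + 1) mod length c)))) = 0] (rmod (2 * pi)) \<longleftrightarrow>
      walk_prod (\<lambda>j k. sgn (ent w j k)) (c @ [hd c]) = 1" if c: "ucycle F c" for c
  proof -
    have ne: "c \<noteq> []"
      using c by (auto simp: ucycle_def)
    have arc: "(c ! i, c ! ((i + 1) mod length c)) \<in> parcs F" if "i < length c" for i
      using c that by (auto simp: F.ucycle_iff vwalk_arcs_close_conv_nth[OF ne])
    have "walk_prod (\<lambda>j k. sgn (ent w j k)) (c @ [hd c]) =
        (\<Prod>i<length c. cis (Arg (ent w (c ! i) (c ! ((i + 1) mod length c)))))"
      unfolding walk_prod_close_conv_prod[OF ne]
      by (intro prod.cong refl cis_Arg[symmetric] nz arc) simp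
    also have "\<dots> = cis (\<Sum>i<length c. Arg (ent w (c ! i) (c ! ((i + 1) mod length c))))"
      by (simp only: cis_sum)
    finally show ?thesis
      using cis_eq_iff[of _ 0] by simp
  qed
  then show ?thesis
    unfolding cycle_condition_def by blast
qed

section \<open>The three implications\<close>

lemma mat_on_psd_rank_1:
  assumes "pair_graph F" "pverts F = {0..n}"
    and W: "W \<in> carrier_mat (n + 1) (n + 1)" "pos_diag W" "psd W" "mat_rank W = 1"
  shows "ppsd F (mat_on F W) \<and> prank1 F (mat_on F W)"
proof -
  interpret F: pair_graph F by fact
  obtain v where outer: "\<And>i j. i < n + 1 \<Longrightarrow> j < n + 1 \<Longrightarrow> W $$ (i, j) = v i * cnj (v j)"
    and nz: "\<And>i. i < n + 1 \<Longrightarrow> v i \<noteq> 0"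
    using psd_rank_1_outer_product[OF W(3,4,2)] W(1) by auto
  have bound: "j < n + 1 \<and> k < n + 1" if "(j, k) \<in> positions F" for j k
    using that F.in_arcsD1 F.in_arcsD2 assms(2) by (fastforce simp: positions_def)
  have ent: "ent (mat_on F W) j k = v j * cnj (v k)" if "(j, k) \<in> positions F" for j k
    using that bound[OF that] outer by (simp add: ent_def mat_on_def)
  have "psd (clique_mat (mat_on F W) q) \<and> mat_rank (clique_mat (mat_on F W) q) = 1"
    if q: "clique F q" for q
  proof -
    have fin: "finite q" "q \<noteq> {}" "q \<subseteq> {0..n}"
      using q finite_subset[OF _ F.pair_finite_verts] assms(2) by (auto simp: clique_def)
    have pick: "pick q a \<in> q" if "a < card q" for a
      using that by (rule pick_in_set_le)
    have pos: "(j, k) \<in> positions F" if "j \<in> q" "k \<in> q" for j k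
      using q that by (auto simp: clique_def positions_def)
    \<comment> \<open>The generator of the clique matrix is \<open>v\<close> read along the clique.
      Cliques are nonempty, so position 0 exists and carries a nonzero entry.\<close>
    show ?thesis
    proof (rule outer_product_psd_rank_1[OF clique_mat_index(1)])
      show "0 < card q"
        using fin by auto
      then show "v (pick q 0) \<noteq> 0"
        using pick[of 0] fin by (intro nz) (auto simp del: pick.simps)
    qed (simp add: ent pos pick)
  qed
  moreover have "ent (mat_on F W) j k = cnj (ent (mat_on F W) k j)" if "(j, k) \<in> positions F" for j k
  proof -
    have "(k, j) \<in> positions F"
      using that F.parcs_sym by (auto simp: positions_def)
    then show ?thesis
      using that by (simp add: ent)
  qed
  ultimately show ?thesis
    by (auto simp: ppsd_def prank1_def)
qed

lemma chordal_extension_restrict: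
  assumes "pair_graph G" "chordal_extension G H"
    and w: "ppos_diag H w" "ppsd H w" "prank1 H w"
  shows "edgewise_psd_rank1 G (pmat_on G w) \<and> cycle_condition G (pmat_on G w)"
proof -
  interpret G: pair_graph G by fact
  interpret H: pair_graph H
    using assms(2) by (simp add: chordal_extension_def)
  have sub: "pverts H = pverts G" "parcs G \<subseteq> parcs H" and chordal: "chordal H"
    using assms(2) by (auto simp: chordal_extension_def spanning_def subgraph_def)
  have diag: "0 < ent w j j" if "j \<in> pverts H" for j
    using w(1) that by (simp add: ppos_diag_def)
  have minor: "ent w i j * ent w k l = ent w i l * ent w k j"
    if "clique H q" "{i, j, k, l} \<subseteq> q" for q i j k l
  proof -
    have "finite q"
      using that(1) finite_subset[OF _ H.pair_finite_verts] by (auto simp: clique_def)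
    then show ?thesis
      using w(3) that by (intro clique_mat_rank_1_minor) (auto simp: prank1_def)
  qed
  have arcs: "ent w k j = cnj (ent w j k)" "ent w j k * ent w k j = ent w j j * ent w k k"
    "0 < ent w j j" "0 < ent w k k" "ent w j k \<noteq> 0"
    if jk: "(j, k) \<in> parcs H" for j k
  proof -
    have v: "j \<in> pverts H" "k \<in> pverts H" and kj: "(k, j) \<in> parcs H"
      using jk H.in_arcsD1 H.in_arcsD2 H.parcs_sym by auto
    show "ent w k j = cnj (ent w j k)"
      using w(2) kj by (auto simp: ppsd_def positions_def)
    have "clique H {j, k}"
      using v jk kj by (auto simp: clique_def)
    then show *: "ent w j k * ent w k j = ent w j j * ent w k k"
      by (rule minor) auto
    show pos: "0 < ent w j j" "0 < ent w k k"
      using v diag by auto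
    show "ent w j k \<noteq> 0"
      using * pos by auto
  qed
  have ent: "ent (pmat_on G w) j k = ent w j k" if "(j, k) \<in> positions G" for j k
    using that by (simp add: ent_def pmat_on_def)
  have ent_arc: "ent (pmat_on G w) j k = ent w j k" "ent (pmat_on G w) k j = ent w k j"
    "ent (pmat_on G w) j j = ent w j j" "ent (pmat_on G w) k k = ent w k k"
    if "(j, k) \<in> parcs G" for j k
    using that G.in_arcsD1 G.in_arcsD2 G.parcs_sym by (auto intro!: ent simp: positions_def)
  have "psd (edge_mat (pmat_on G w) j k) \<and> mat_rank (edge_mat (pmat_on G w) j k) = 1"
    if jk: "(j, k) \<in> parcs G" for j k
  proof -
    have "(j, k) \<in> parcs H"
      using jk sub by auto
    from arcs[OF this] show ?thesis
      by (subst edge_mat_psd_rank_1_iff) (simp_all only: ent_arc[OF jk] simp_thms)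
  qed
  then have "edgewise_psd_rank1 G (pmat_on G w)"
    by (auto simp: edgewise_psd_rank1_def)
  moreover have "cycle_condition G (pmat_on G w)"
  proof (subst cycle_condition_iff, rule assms(1))
    show "ent (pmat_on G w) j k \<noteq> 0" if "(j, k) \<in> parcs G" for j k
      using arcs(5) sub ent_arc[OF that] that by auto
    let ?u = "\<lambda>j k. sgn (ent w j k)"
    have "walk_prod (\<lambda>j k. sgn (ent (pmat_on G w) j k)) (c @ [hd c]) = 1" if c: "ucycle G c" for c
    proof -
      have "walk_prod (\<lambda>j k. sgn (ent (pmat_on G w) j k)) (c @ [hd c]) = walk_prod ?u (c @ [hd c])"
        using c ent_arc unfolding walk_prod_def G.ucycle_iff
        by (intro arg_cong[of _ _ prod_list] map_cong) auto
      \<comment> \<open>The cycle is now viewed in \<open>H\<close>, where the chords that cut it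
        into triangles are available and \<open>w\<close> has phases on them.\<close>
      also have "\<dots> = 1"
      proof (rule H.chordal_cycle_walk_prod[OF chordal])
        show "?u x y * ?u y x = 1" if "(x, y) \<in> parcs H" for x y
        proof -
          have "?u x y * ?u y x = sgn (ent w x x) * sgn (ent w y y)"
            using arcs(2)[OF that] by (metis sgn_mult)
          then show ?thesis
            using arcs(3,4)[OF that] by (simp add: sgn_pos_complex)
        qed
        show "?u x y * ?u y z * ?u z x = 1" if xyz: "clique H {x, y, z}" for x y z
        proof -
          \<comment> \<open>Two minors of the triangle replace the product around it by the product
            of its three diagonal entries, which is positive.\<close>
          have "ent w x y * (ent w y z * ent w z x) = ent w x y * ent w y x * ent w z z"
            using minor[OF xyz, of y z z x] by (simp add: mult_ac)
          also have "ent w x y * ent w y x = ent w x x * ent w y y"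
            using minor[OF xyz, of x y y x] by simp
          finally have "?u x y * ?u y z * ?u z x = ?u x x * ?u y y * ?u z z"
            by (metis sgn_mult mult.assoc)
          moreover have "{x, y, z} \<subseteq> pverts H"
            using xyz by (simp add: clique_def)
          ultimately show ?thesis
            using diag by (simp add: sgn_pos_complex)
        qed
        show "ucycle H c"
          using c sub by (auto simp: G.ucycle_iff H.ucycle_iff)
      qed
      finally show ?thesis .
    qed
    then show "\<forall>c. ucycle G c \<longrightarrow>
        walk_prod (\<lambda>j k. sgn (ent (pmat_on G w) j k)) (c @ [hd c]) = 1"
      by blast
  qed
  ultimately show ?thesis
    by blast
qed

lemma norm_walk_prod:
  fixes u :: "'a \<Rightarrow> 'a \<Rightarrow> complex"
  assumes "\<And>x y. (x, y) \<in> set (vwalk_arcs p) \<Longrightarrow> norm (u x y) = 1"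
  shows "norm (walk_prod u p) = 1"
  using assms by (induction p rule: vwalk_arcs.induct) (auto simp: walk_prod_def norm_mult)

lemma psd_rank_1_completion:
  assumes "pair_graph G" "pverts G = {0..n}" "Digraph_Component.connected (with_proj G)"
    and w: "ppos_diag G w" "edgewise_psd_rank1 G w" "cycle_condition G w"
  shows "\<exists>W. completion G w W \<and> psd W \<and> mat_rank W = 1"
proof -
  interpret G: pair_graph G by fact
  define d where "d j = Re (ent w j j)" for j
  have d: "0 < d j" "ent w j j = complex_of_real (d j)" if "j \<in> pverts G" for j
    using w(1) that by (auto simp: ppos_diag_def d_def less_complex_def complex_eq_iff)
  let ?u = "\<lambda>j k. sgn (ent w j k)"
  have arcs: "ent w k j = cnj (ent w j k)" "norm (ent w j k) = sqrt (d j) * sqrt (d k)"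
    "ent w j k \<noteq> 0" if jk: "(j, k) \<in> parcs G" for j k
  proof -
    have v: "j \<in> pverts G" "k \<in> pverts G"
      using jk G.in_arcsD1 G.in_arcsD2 by auto
    then have "psd (edge_mat w j k) \<and> mat_rank (edge_mat w j k) = 1"
      "0 < ent w j j" "0 < ent w k k"
      using w(1,2) jk by (auto simp: edgewise_psd_rank1_def ppos_diag_def)
    then have eq: "ent w k j = cnj (ent w j k)" "ent w j k * ent w k j = ent w j j * ent w k k"
      using edge_mat_psd_rank_1_iff by blast+
    show "ent w k j = cnj (ent w j k)" by fact
    \<comment> \<open>Hermitian symmetry turns the determinant equation into one for the squared
      modulus of the entry.\<close>
    have "complex_of_real ((norm (ent w j k))\<^sup>2) = complex_of_real (d j * d k)"
      using eq(2) unfolding eq(1) complex_norm_square d(2)[OF v(1)] d(2)[OF v(2)] by simp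
    then have "(norm (ent w j k))\<^sup>2 = d j * d k"
      using of_real_eq_iff by blast
    then show n: "norm (ent w j k) = sqrt (d j) * sqrt (d k)"
      by (metis real_sqrt_mult real_sqrt_unique norm_ge_zero)
    show "ent w j k \<noteq> 0"
      using n d(1)[OF v(1)] d(1)[OF v(2)] by auto
  qed
  have unit: "norm (?u j k) = 1" if "(j, k) \<in> parcs G" for j k
    using arcs(3)[OF that] by (simp add: norm_sgn)
  have u_inv: "?u j k * ?u k j = 1" if "(j, k) \<in> parcs G" for j k
    using arcs(3)[OF that] unfolding arcs(1)[OF that]
    by (simp add: sgn_eq field_simps flip: complex_norm_square power2_eq_square)
  have cycle: "walk_prod ?u (c @ [hd c]) = 1" if "ucycle G c" for c
    using w(3) cycle_condition_iff[OF assms(1) arcs(3)] that by blast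
  obtain \<theta> where step: "\<And>x y. (x, y) \<in> parcs G \<Longrightarrow> \<theta> y = \<theta> x * ?u x y"
    and path: "\<And>x. x \<in> pverts G \<Longrightarrow> \<exists>p. set (vwalk_arcs p) \<subseteq> parcs G \<and> \<theta> x = walk_prod ?u p"
    using G.connected_potential[of ?u, OF assms(3) u_inv cycle] by blast
  have \<theta>: "cnj (\<theta> x) * \<theta> x = 1" if x: "x \<in> pverts G" for x
  proof -
    obtain p where "set (vwalk_arcs p) \<subseteq> parcs G" "\<theta> x = walk_prod ?u p"
      using path[OF x] by blast
    then have "norm (\<theta> x) = 1"
      using unit by (auto intro!: norm_walk_prod)
    then show ?thesis
      using complex_norm_square[of "\<theta> x"] by (simp add: mult.commute)
  qed
  (* v carries the conjugate phase: \<theta> accumulates the phases away from the root, so the phase of w on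
     the edge j k is cnj (\<theta> j) * \<theta> k. *)
  define v where "v j = complex_of_real (sqrt (d j)) * cnj (\<theta> j)" for j
  define W where "W = mat (n + 1) (n + 1) (\<lambda>(j, k). v j * cnj (v k))"
  have diag: "v j * cnj (v j) = ent w j j" if "j \<in> pverts G" for j
  proof -
    have "v j * cnj (v j) =
        (complex_of_real (sqrt (d j)) * complex_of_real (sqrt (d j))) * (cnj (\<theta> j) * \<theta> j)"
      by (simp add: v_def mult_ac)
    then show ?thesis
      using \<theta>[OF that] d[OF that] by (simp only: complex_of_real_sqrt_mult_self less_imp_le mult_1_right)
  qed
  have edge: "v j * cnj (v k) = ent w j k" if jk: "(j, k) \<in> parcs G" for j k
  proof -
    \<comment> \<open>The potential step rewrites \<open>\<theta> k\<close> as
      \<open>\<theta> j * ?u j k\<close>; the factors at \<open>j\<close> then cancel, leaving the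
      modulus and phase of the entry.\<close>
    have "v j * cnj (v k) = complex_of_real (sqrt (d j) * sqrt (d k)) * (cnj (\<theta> j) * \<theta> j) * ?u j k"
      using step[OF jk] by (simp add: v_def mult_ac)
    also have "\<dots> = complex_of_real (norm (ent w j k)) * ?u j k"
      using \<theta>[of j] jk G.in_arcsD1 arcs(2)[OF jk] by simp
    also have "\<dots> = ent w j k"
      using arcs(3)[OF jk] by (simp add: sgn_eq)
    finally show ?thesis .
  qed
  have "completion G w W"
    using diag edge G.in_arcsD1 G.in_arcsD2 assms(2)
    by (fastforce simp: completion_def positions_def W_def)
  moreover have "psd W \<and> mat_rank W = 1"
  proof (rule outer_product_psd_rank_1)
    show "v 0 \<noteq> 0"
      using diag[of 0] d[of 0] assms(2) by auto
  qed (auto simp: W_def)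
  ultimately show ?thesis
    by blast
qed

theorem theorem2:
  fixes n :: nat and G cG :: "nat pair_pre_digraph"
  assumes "pair_graph G"
    and "pverts G = {0..n}"
    and "Digraph_Component.connected (with_proj G)"
    and "chordal_extension G cG"
  shows
    "(\<forall>W \<in> carrier_mat (n + 1) (n + 1). pos_diag W \<and> psd W \<and> mat_rank W = 1 \<longrightarrow>
        ppsd cG (mat_on cG W) \<and> prank1 cG (mat_on cG W)) \<and>
     (\<forall>w. partial_mat cG w \<and> ppos_diag cG w \<and> ppsd cG w \<and> prank1 cG w \<longrightarrow>
        edgewise_psd_rank1 G (pmat_on G w) \<and> cycle_condition G (pmat_on G w)) \<and>
     (\<forall>w. partial_mat G w \<and> ppos_diag G w \<and> edgewise_psd_rank1 G w \<and> cycle_condition G w \<longrightarrow>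
        (\<exists>W. completion G w W \<and> psd W \<and> mat_rank W = 1))"
proof -
  have "pair_graph cG" "pverts cG = {0..n}"
    using assms(2,4) by (auto simp: chordal_extension_def spanning_def)
  then show ?thesis
    using mat_on_psd_rank_1 chordal_extension_restrict[OF assms(1,4)] psd_rank_1_completion[OF assms(1-3)]
    by blast
qed

end
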